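(* The family of graphs with maximal degree $d$ has a labeling scheme (in the adversarial model described in the context) with labels of size $O(d)$ bits. More specifically, for probability of forgery $\varepsilon\in(0,1)$ the label size is $2d\log(1/\varepsilon)(1+o(1))$ bits.
   Context: Logarithms are base 2. A labeling scheme (adjacency sketch) for a family of graphs consists of a randomized encoder that, given a graph $G$ in the family, outputs a labeling $\ell:V(G)\to\{0,1\}^c$ ($c$ is the size), and a deterministic decoder $\mathcal D:\{0,1\}^*\times\{0,1\}^*\to\{0,1\}$; the scheme errs only on non-edges, i.e. $\mathcal D(\ell(u),\ell(v))=1$ always holds for edges $(u,v)$. Adversarial game: the adversary chooses $G$ in the family with $n$ vertices; labels are drawn by the encoder; the (computationally unbounded) adversary adaptively requests the labels of vertices $x_1,\dots,x_k$, $k\le n-2$, each choice possibly depending on earlier answers; it then names two distinct vertices $x_{k+1},x_{k+2}$ not previously queried. It wins if $(x_{k+1},x_{k+2})\notin E(G)$ but $\mathcal D(\ell(x_{k+1}),\ell(x_{k+2}))=1$. The probability of forgery is the maximum over adversaries of the winning probability. *)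

theory Defs
  imports "HOL-Probability.Probability" "Graph_Theory.Pair_Digraph" "HOL-Library.Landau_Symbols"
begin

text \<open>
  Every finite simple graph is isomorphic to one whose vertices are natural numbers. A
  \<^const>\<open>pair_graph\<close> is a finite, symmetric, loop-free digraph, that is, a finite simple graph in
  which an edge \<open>uv\<close> is represented by both pairs \<open>(u, v)\<close> and \<open>(v, u)\<close>; hence the degree of a
  vertex is its out-degree.
\<close>

type_synonym sgraph = "nat pair_pre_digraph"

definition max_degree_graphs :: "nat \<Rightarrow> sgraph set" where
  "max_degree_graphs d = {G. pair_graph G \<and> (\<forall>v\<in>pverts G. out_degree (with_proj G) v \<le> d)}"

type_synonym label = "bool list"
type_synonym labeling = "nat \<Rightarrow> label"
type_synonym encoder = "sgraph \<Rightarrow> labeling pmf"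
type_synonym decoder = "label \<Rightarrow> label \<Rightarrow> bool"

text \<open>Values of a labeling outside \<open>pverts G\<close> are irrelevant.\<close>

definition labeling_scheme :: "sgraph set \<Rightarrow> nat \<Rightarrow> encoder \<Rightarrow> decoder \<Rightarrow> bool" where
  "labeling_scheme F c E D \<longleftrightarrow>
     (\<forall>G\<in>F. \<forall>l\<in>set_pmf (E G).
        (\<forall>v\<in>pverts G. length (l v) = c) \<and>
        (\<forall>(u, v)\<in>parcs G. D (l u) (l v)))"

text \<open>
  A strategy of the adversary, as a decision tree: \<open>Query x f\<close> requests the label of \<open>x\<close> and
  continues with \<open>f a\<close> on the answer \<open>a\<close>; \<open>Name u v\<close> ends the game with the pair \<open>(u, v)\<close>. The
  tree is chosen knowing the graph and the scheme. Strategies are deterministic; mixing them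
  would not change the supremum of the winning probabilities.
\<close>

datatype adversary = Name nat nat | Query nat "label \<Rightarrow> adversary"

primrec named_pair :: "labeling \<Rightarrow> adversary \<Rightarrow> nat \<times> nat" where
  "named_pair l (Name u v) = (u, v)"
| "named_pair l (Query x f) = named_pair l (f (l x))"

text \<open>
  \<open>U\<close> is the set of vertices not queried so far. Queried vertices are pairwise distinct and two
  distinct unqueried vertices remain at the end, so at most \<open>n - 2\<close> queries are made on \<open>n\<close>
  vertices.
\<close>

primrec legal :: "adversary \<Rightarrow> nat set \<Rightarrow> bool" where
  "legal (Name u v) U \<longleftrightarrow> u \<in> U \<and> v \<in> U \<and> u \<noteq> v"
| "legal (Query x f) U \<longleftrightarrow> x \<in> U \<and> (\<forall>a. legal (f a) (U - {x}))"

definition win_prob :: "encoder \<Rightarrow> decoder \<Rightarrow> sgraph \<Rightarrow> adversary \<Rightarrow> real" where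
  "win_prob E D G A =
     measure_pmf.prob (E G)
       {l. case named_pair l A of (u, v) \<Rightarrow> (u, v) \<notin> parcs G \<and> D (l u) (l v)}"

text \<open>
  The adversary chooses both the graph and the strategy. The supremum is only meaningful if the
  family has a graph with \<open>n\<close> vertices and \<open>n \<ge> 2\<close>; otherwise no legal play exists.
\<close>

definition forgery_prob :: "sgraph set \<Rightarrow> encoder \<Rightarrow> decoder \<Rightarrow> nat \<Rightarrow> real" where
  "forgery_prob F E D n =
     (SUP (G, A)\<in>{(G, A). G \<in> F \<and> card (pverts G) = n \<and> legal A (pverts G)}. win_prob E D G A)"

end

theory Submission
  imports Defs "HOL-Real_Asymp.Real_Asymp"
begin

text \<open>
  The decoder is a symmetric relation on bit strings of length \<open>c\<close> of density slightly below \<open>\<epsilon>\<close>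
  such that any \<open>d\<close> strings have at least \<open>k\<close> common neighbours and any two sets of at least \<open>k\<close>
  strings have density at most \<open>\<epsilon>\<close> between them; a random relation has both properties as soon as
  \<open>2\<^sup>c\<close> exceeds \<open>\<epsilon>\<close> to the power \<open>-(d + 1)\<close> by a factor polynomial in \<open>c\<close> and \<open>d\<close>. The encoder
  draws a uniformly random homomorphism from \<open>G\<close> into this relation. Conditioned on all labels except
  those of two non-adjacent vertices, the latter are independent and uniform on the common
  neighbourhoods of the labels around them, so the forgery succeeds with probability at most \<open>\<epsilon>\<close>.
  Since \<open>d + 1 \<le> 2 * d\<close>, the length \<open>2 * d * log 2 (1 / \<epsilon>)\<close> plus a logarithmic slack suffices.
\<close>

section \<open>Random relations\<close>

abbreviation random_subset :: "'b set \<Rightarrow> real \<Rightarrow> ('b \<Rightarrow> bool) pmf" where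
  "random_subset U p \<equiv> Pi_pmf U False (\<lambda>_. bernoulli_pmf p)"

lemma finite_set_random_subset:
  assumes "finite U"
  shows "finite (set_pmf (random_subset U p))"
  by (rule finite_subset[OF set_Pi_pmf_subset'[OF assms]]) (auto intro: assms)

lemma integrable_random_subset:
  assumes "finite U"
  shows "integrable (measure_pmf (random_subset U p)) (f :: _ \<Rightarrow> real)"
  by (rule integrable_measure_pmf_finite[OF finite_set_random_subset[OF assms]])

lemma expectation_prod_random_subset:
  assumes "finite U" "0 \<le> p" "p \<le> 1" "\<And>e y. e \<in> U \<Longrightarrow> 0 \<le> f e y"
  shows "measure_pmf.expectation (random_subset U p) (\<lambda>w. \<Prod>e\<in>U. f e (w e)) =
    (\<Prod>e\<in>U. p * f e True + (1 - p) * f e False)"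
  using assms by (subst expectation_prod_Pi_pmf) (auto intro!: integrable_measure_pmf_finite simp: mult.commute)

lemma expectation_random_subset_superset:
  assumes "finite U" "0 \<le> p" "p \<le> 1" "T \<subseteq> U"
  shows "measure_pmf.expectation (random_subset U p) (\<lambda>w. of_bool (\<forall>e\<in>T. w e)) = p ^ card T"
proof -
  have fT: "finite T" using assms finite_subset by blast
  have "of_bool (\<forall>e\<in>T. w e) = (\<Prod>e\<in>U. if e \<in> T then of_bool (w e) else (1::real))" for w
  proof -
    have "(\<Prod>e\<in>U. if e \<in> T then of_bool (w e) else (1::real)) = (\<Prod>e\<in>T. of_bool (w e))"
      using assms by (simp add: prod.If_cases Int_absorb1)
    then show ?thesis using fT by (auto intro!: prod_zero)
  qed
  then have "measure_pmf.expectation (random_subset U p) (\<lambda>w. of_bool (\<forall>e\<in>T. w e)) =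
      measure_pmf.expectation (random_subset U p)
        (\<lambda>w. \<Prod>e\<in>U. (\<lambda>e y. if e \<in> T then of_bool y else (1::real)) e (w e))"
    by simp
  also have "\<dots> = (\<Prod>e\<in>U. if e \<in> T then p else 1)"
    using assms by (subst expectation_prod_random_subset) (auto intro!: prod.cong)
  also have "\<dots> = p ^ card T"
    using assms by (simp add: prod.If_cases Int_absorb1)
  finally show ?thesis .
qed

text \<open>Expanding the product over subsets \<open>Z\<close> of \<open>I\<close> turns a product
  of block indicators into the indicator of the union of the blocks, which has
  \<open>m * card Z\<close> elements by disjointness. Taking expectations termwise and folding the
  expansion back gives the right-hand side.\<close>

lemma expectation_prod_disjoint_blocks:
  fixes c :: real
  assumes U: "finite U" "0 \<le> p" "p \<le> 1"
    and I: "finite I" "\<And>i. i \<in> I \<Longrightarrow> B i \<subseteq> U" "\<And>i. i \<in> I \<Longrightarrow> card (B i) = m"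
    and disj: "disjoint_family_on B I"
  shows "measure_pmf.expectation (random_subset U p)
      (\<lambda>w. \<Prod>i\<in>I. 1 - c * of_bool (\<forall>e\<in>B i. w e)) = (1 - c * p ^ m) ^ card I"
proof -
  have block: "(\<Prod>i\<in>Z. c * of_bool (\<forall>e\<in>B i. w e)) = c ^ card Z * of_bool (\<forall>e\<in>(\<Union>i\<in>Z. B i). w e)"
    if "Z \<subseteq> I" for Z and w :: "'a \<Rightarrow> bool"
  proof -
    have "finite Z" using that I finite_subset by blast
    then show ?thesis by (induction Z) (simp_all add: ball_Un of_bool_conj mult_ac)
  qed
  have cardB: "card (\<Union>i\<in>Z. B i) = m * card Z" if "Z \<subseteq> I" for Z
  proof -
    have "finite Z" using that I finite_subset by blast
    moreover have "finite (B i)" if "i \<in> Z" for i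
      using I(2) U(1) \<open>Z \<subseteq> I\<close> that by (meson finite_subset subsetD)
    ultimately have "card (\<Union>i\<in>Z. B i) = (\<Sum>i\<in>Z. card (B i))"
      using disj that by (intro card_UN_disjoint) (auto simp: disjoint_family_on_def)
    then show ?thesis using I(3) that by (simp add: subset_iff)
  qed
  have expand: "(\<Prod>i\<in>I. 1 - c * of_bool (\<forall>e\<in>B i. w e)) =
      (\<Sum>Z\<in>Pow I. (-1) ^ card Z * c ^ card Z * of_bool (\<forall>e\<in>(\<Union>i\<in>Z. B i). w e))"
    for w :: "'a \<Rightarrow> bool"
    unfolding prod_diff_conv_sum[OF I(1)] by (intro sum.cong refl) (subst block, auto)
  have "measure_pmf.expectation (random_subset U p)
      (\<lambda>w. \<Prod>i\<in>I. 1 - c * of_bool (\<forall>e\<in>B i. w e)) =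
    measure_pmf.expectation (random_subset U p)
      (\<lambda>w. \<Sum>Z\<in>Pow I. (-1) ^ card Z * c ^ card Z * of_bool (\<forall>e\<in>(\<Union>i\<in>Z. B i). w e))"
    by (simp add: expand)
  also have "\<dots> = (\<Sum>Z\<in>Pow I. (-1) ^ card Z * c ^ card Z *
      measure_pmf.expectation (random_subset U p) (\<lambda>w. of_bool (\<forall>e\<in>(\<Union>i\<in>Z. B i). w e)))"
    using U(1) by (subst Bochner_Integration.integral_sum)
      (auto intro: integrable_random_subset)
  also have "\<dots> = (\<Sum>Z\<in>Pow I. (-1) ^ card Z * c ^ card Z * p ^ (m * card Z))"
    using U I(2) by (intro sum.cong refl, subst expectation_random_subset_superset)
      (auto simp: cardB)
  also have "\<dots> = (\<Prod>i\<in>I. 1 - c * p ^ m)"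
    using I(1) by (subst prod_diff_conv_sum) (auto simp: power_mult power_mult_distrib intro!: sum.cong)
  finally show ?thesis by simp
qed

text \<open>
  An unordered pair is counted twice in \<open>X \<times> Y\<close> if both its elements lie in \<open>X \<inter> Y\<close>. The exponent
  \<open>ln (1 + \<delta>) / 2\<close> makes the bound linear in these multiplicities.
\<close>

lemma expectation_exp_weighted_le:
  fixes n :: "'b \<Rightarrow> nat"
  assumes U: "finite U" "0 \<le> p" "p \<le> 1" and n: "\<And>e. e \<in> U \<Longrightarrow> n e \<le> 2" and \<delta>: "0 \<le> \<delta>"
  shows "measure_pmf.expectation (random_subset U p)
      (\<lambda>w. exp (ln (1 + \<delta>) / 2 * (\<Sum>e\<in>U. real (n e) * of_bool (w e)))) \<le>
    exp (p * \<delta> / 2 * real (\<Sum>e\<in>U. n e))"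
proof -
  let ?t = "ln (1 + \<delta>) / 2"
  have le: "exp (?t * real (n e)) - 1 \<le> \<delta> / 2 * real (n e)" if "e \<in> U" for e
  proof -
    have sq: "exp ?t ^ 2 = 1 + \<delta>" using \<delta> by (simp flip: exp_double)
    \<comment> \<open>Here \<open>exp ?t\<close> is the square root of \<open>1 + \<delta>\<close>,
      so this is the bound \<open>1 + \<delta> / 2\<close> on that root and settles multiplicity 1.
      Multiplicity 2 holds with equality.\<close>
    have "2 * exp ?t \<le> exp ?t ^ 2 + 1" using sum_power2_ge_zero[of "exp ?t - 1" 0]
      by (simp add: power2_diff)
    then have one: "exp ?t - 1 \<le> \<delta> / 2" using sq by simp
    have "n e = 0 \<or> n e = 1 \<or> n e = 2" using n[OF that] by linarith
    then show ?thesis using one sq \<delta> by (auto simp: exp_double)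
  qed
  have "measure_pmf.expectation (random_subset U p)
      (\<lambda>w. exp (?t * (\<Sum>e\<in>U. real (n e) * of_bool (w e)))) =
    measure_pmf.expectation (random_subset U p)
      (\<lambda>w. \<Prod>e\<in>U. (\<lambda>e y. exp (?t * (real (n e) * of_bool y))) e (w e))"
    using U(1) by (simp only: sum_distrib_left exp_sum)
  also have "\<dots> = (\<Prod>e\<in>U. p * exp (?t * real (n e)) + (1 - p))"
    using U by (subst expectation_prod_random_subset) auto
  also have "\<dots> \<le> (\<Prod>e\<in>U. exp (p * \<delta> / 2 * real (n e)))"
  proof (intro prod_mono conjI)
    fix e assume e: "e \<in> U"
    show "0 \<le> p * exp (?t * real (n e)) + (1 - p)" using U by simp
    have "p * exp (?t * real (n e)) + (1 - p) = 1 + p * (exp (?t * real (n e)) - 1)"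
      by (simp add: algebra_simps)
    also have "\<dots> \<le> 1 + p * (\<delta> / 2 * real (n e))"
      using le[OF e] U by (intro add_left_mono mult_left_mono) auto
    also have "\<dots> \<le> exp (p * \<delta> / 2 * real (n e))"
      using exp_ge_add_one_self[of "p * \<delta> / 2 * real (n e)"] by (simp add: mult_ac)
    finally show "p * exp (?t * real (n e)) + (1 - p) \<le> exp (p * \<delta> / 2 * real (n e))" .
  qed
  also have "\<dots> = exp (p * \<delta> / 2 * real (\<Sum>e\<in>U. n e))"
    using U(1) by (simp add: exp_sum[symmetric] sum_distrib_left)
  finally show ?thesis .
qed

section \<open>First moment method for the random relation\<close>

text \<open>Each unordered pair, loops included, is related independently with probability
  \<open>\<epsilon> * (1 - 2 * \<delta>)\<close>. The two summands in \<open>small\<close> bound the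
  expected exponential penalties for too few common neighbours and for too dense pairs of sets. As
  they total less than 1, some outcome avoids every violation.\<close>

lemma exists_quasirandom_relation:
  fixes S :: "'a set" and d k :: nat and \<epsilon> \<delta> :: real
  assumes S: "finite S" and k: "k \<ge> 1" and \<epsilon>: "0 < \<epsilon>" "\<epsilon> \<le> 1" and \<delta>: "0 < \<delta>" "\<delta> \<le> 1 / 2"
    and small: "real (card S) ^ d * 2 ^ k * (1 - (\<epsilon> * (1 - 2 * \<delta>)) ^ d / 2) ^ (card S - d) +
      ((1 + exp (- (k * \<epsilon> * \<delta>\<^sup>2 / 4))) ^ card S - 1)\<^sup>2 < 1"
  shows "\<exists>R. (\<forall>x y. R x y = R y x) \<and>
    (\<forall>A\<subseteq>S. card A = d \<longrightarrow> k \<le> card {x \<in> S. \<forall>a\<in>A. R x a}) \<and>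
    (\<forall>X\<subseteq>S. \<forall>Y\<subseteq>S. k \<le> card X \<longrightarrow> k \<le> card Y \<longrightarrow>
      real (card {(x, y) \<in> X \<times> Y. R x y}) \<le> \<epsilon> * card X * card Y)"
proof -
  define U where "U = (\<lambda>(x, y). {x, y}) ` (S \<times> S)"
  define p where "p = \<epsilon> * (1 - 2 * \<delta>)"
  define t where "t = ln (1 + \<delta>) / 2"
  define r where "r = exp (- (k * \<epsilon> * \<delta>\<^sup>2 / 4))"
  define \<A> where "\<A> = {A. A \<subseteq> S \<and> card A = d}"
  define \<X> where "\<X> = {X. X \<subseteq> S \<and> k \<le> card X}"
  let ?E = "measure_pmf.expectation (random_subset U p)"
  let ?e = "\<lambda>w X Y. card {(x, y) \<in> X \<times> Y. w {x, y}}"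
  \<comment> \<open>This is 2 to the power \<open>k\<close> minus the number of common neighbours of
    \<open>A\<close> outside \<open>A\<close>. Restricting \<open>x\<close> to \<open>S - A\<close>
    makes the blocks of pairs at different \<open>x\<close> disjoint.\<close>
  define f :: "_ \<Rightarrow> _ \<Rightarrow> real" where "f A w = 2 ^ k * (\<Prod>x\<in>S - A. 1 - 1 / 2 * of_bool (\<forall>e\<in>(\<lambda>a. {x, a}) ` A. w e))"
    for A :: "'a set" and w :: "'a set \<Rightarrow> bool"
  \<comment> \<open>The exponential of \<open>t\<close> times the excess of the number of related
    pairs over \<open>\<epsilon> * card X * card Y\<close>.\<close>
  define g :: "_ \<Rightarrow> _ \<Rightarrow> _ \<Rightarrow> real" where "g X Y w = exp (t * ?e w X Y) * exp (- (t * \<epsilon> * card X * card Y))"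
    for X Y :: "'a set" and w :: "'a set \<Rightarrow> bool"
  have finU: "finite U" using S by (simp add: U_def)
  have p: "0 \<le> p" "p \<le> 1"
    using \<epsilon> \<delta> by (auto simp: p_def intro!: mult_le_one)
  have t: "0 < t" using \<delta> by (simp add: t_def)
  have fin: "finite \<A>" "finite \<X>" using S by (auto simp: \<A>_def \<X>_def)
  have finX: "finite X" if "X \<in> \<X>" for X
    using that S by (auto simp: \<X>_def intro: finite_subset)
  note int [simp] = integrable_random_subset[OF finU]

  have Ef: "?E (f A) = 2 ^ k * (1 - p ^ d / 2) ^ (card S - d)" if "A \<in> \<A>" for A
  proof -
    have A: "A \<subseteq> S" "card A = d" "finite A"
      using that S by (auto simp: \<A>_def intro: finite_subset)
    have "?E (\<lambda>w. \<Prod>x\<in>S - A. 1 - 1 / 2 * of_bool (\<forall>e\<in>(\<lambda>a. {x, a}) ` A. w e)) =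
      (1 - 1 / 2 * p ^ d) ^ card (S - A)"
    proof (rule expectation_prod_disjoint_blocks[OF finU p])
      show "disjoint_family_on (\<lambda>x. (\<lambda>a. {x, a}) ` A) (S - A)"
        by (auto simp: disjoint_family_on_def doubleton_eq_iff)
      show "card ((\<lambda>a. {x, a}) ` A) = d" if "x \<in> S - A" for x
        using A that by (subst card_image) (auto simp: inj_on_def doubleton_eq_iff)
      show "(\<lambda>a. {x, a}) ` A \<subseteq> U" if "x \<in> S - A" for x
        using A that by (auto simp: U_def)
    qed (use S in auto)
    then show ?thesis using A S unfolding f_def by (simp add: card_Diff_subset)
  qed
  have Eg: "?E (g X Y) \<le> r ^ card X * r ^ card Y" if XY: "X \<in> \<X>" "Y \<in> \<X>" for X Y
  proof -
    \<comment> \<open>The multiplicity of the unordered pair \<open>e\<close> in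
      \<open>X \<times> Y\<close>: weighting by it counts the ordered related pairs.\<close>
    define n where "n e = card {(x, y) \<in> X \<times> Y. {x, y} = e}" for e
    have fXY: "finite (X \<times> Y)" using XY finX by blast
    have sub: "(\<lambda>(x, y). {x, y}) ` (X \<times> Y) \<subseteq> U"
      using XY by (auto simp: U_def \<X>_def)
    have n2: "n e \<le> 2" if e: "e \<in> U" for e
    proof -
      obtain a b where "e = {a, b}" using e by (auto simp: U_def)
      then have "{(x, y) \<in> X \<times> Y. {x, y} = e} \<subseteq> {(a, b), (b, a)}"
        by (auto simp: doubleton_eq_iff)
      then have "n e \<le> card {(a, b), (b, a)}" unfolding n_def by (intro card_mono) auto
      also have "\<dots> \<le> 2" using card_insert_le_m1[of 2 "{(b, a)}" "(a, b)"] by simp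
      finally show ?thesis .
    qed
    have weighted: "(\<Sum>e\<in>U. real (n e) * of_bool (w e)) = ?e w X Y" for w
    proof -
      define F :: "'a \<times> 'a \<Rightarrow> 'a set" where "F = (\<lambda>(x, y). {x, y})"
      have F: "{(x, y) \<in> X \<times> Y. P {x, y}} = {q \<in> X \<times> Y. P (F q)}" for P
        by (auto simp: F_def)
      have "real (n e) * of_bool (w e) = (\<Sum>q\<in>{q \<in> X \<times> Y. F q = e}. of_bool (w (F q)))" for e
        unfolding n_def F[of "\<lambda>z. z = e"] by simp
      then have "(\<Sum>e\<in>U. real (n e) * of_bool (w e)) =
        (\<Sum>e\<in>U. \<Sum>q\<in>{q \<in> X \<times> Y. F q = e}. of_bool (w (F q)))"
        by (rule sum.cong[OF refl])
      also have "\<dots> = (\<Sum>q\<in>X \<times> Y. of_bool (w (F q)))"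
        using finU fXY sub unfolding F_def by (intro sum.group)
      also have "\<dots> = card {q \<in> X \<times> Y. w (F q)}"
        using fXY by (simp add: sum_of_bool_eq Int_def)
      finally show ?thesis unfolding F .
    qed
    have total: "(\<Sum>e\<in>U. n e) = card X * card Y"
    proof -
      have "real (\<Sum>e\<in>U. n e) = real (card X * card Y)"
        using weighted[of "\<lambda>_. True"] by (simp add: card_cartesian_product)
      then show ?thesis by (simp only: of_nat_eq_iff)
    qed
    have "?E (g X Y) = ?E (\<lambda>w. exp (t * (\<Sum>e\<in>U. real (n e) * of_bool (w e)))) *
      exp (- (t * \<epsilon> * card X * card Y))"
      unfolding g_def weighted by simp
    also have "\<dots> \<le> exp (p * \<delta> / 2 * real (card X * card Y)) * exp (- (t * \<epsilon> * card X * card Y))"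
      using expectation_exp_weighted_le[where n = n and \<delta> = \<delta>, OF finU p n2] \<delta>
      by (intro mult_right_mono) (auto simp: t_def total)
    also have "\<dots> = exp ((p * \<delta> / 2 - t * \<epsilon>) * (real (card X) * real (card Y)))"
      by (simp flip: exp_add add: algebra_simps)
    also have "\<dots> \<le> exp (- (\<epsilon> * \<delta>\<^sup>2 / 2) * (real k * (real (card X) + real (card Y)) / 2))"
    proof -
      \<comment> \<open>From \<open>ln (1 + \<delta>) \<ge> \<delta> - \<delta>^2\<close>. The
        density was lowered by \<open>2 * \<delta> * \<epsilon>\<close>, which covers this
        second-order loss twice and leaves a negative exponent of order
        \<open>\<delta>^2\<close>.\<close>
      have "(\<delta> - \<delta>\<^sup>2) / 2 * \<epsilon> \<le> t * \<epsilon>"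
        using ln_one_plus_pos_lower_bound[of \<delta>] \<delta> \<epsilon> by (intro mult_right_mono) (auto simp: t_def)
      moreover have "p * \<delta> / 2 - (\<delta> - \<delta>\<^sup>2) / 2 * \<epsilon> = - (\<epsilon> * \<delta>\<^sup>2 / 2)"
        by (simp add: p_def field_simps power2_eq_square)
      ultimately have 1: "p * \<delta> / 2 - t * \<epsilon> \<le> - (\<epsilon> * \<delta>\<^sup>2 / 2)" by linarith
      \<comment> \<open>Replacing the product of the cardinalities by a multiple of their sum makes
        the bound factor into \<open>r ^ card X * r ^ card Y\<close>, so that the sum over all pairs
        of sets becomes a square.\<close>
      have "real k * real (card Y) \<le> real (card X) * real (card Y)"
        "real k * real (card X) \<le> real (card Y) * real (card X)"
        using XY by (auto simp: \<X>_def intro!: mult_right_mono)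
      then have 2: "real k * (real (card X) + real (card Y)) / 2 \<le> real (card X) * real (card Y)"
        by (simp add: algebra_simps)
      have "(p * \<delta> / 2 - t * \<epsilon>) * (real (card X) * real (card Y)) \<le>
          - (\<epsilon> * \<delta>\<^sup>2 / 2) * (real (card X) * real (card Y))"
        by (rule mult_right_mono[OF 1]) simp
      also have "\<dots> \<le> - (\<epsilon> * \<delta>\<^sup>2 / 2) * (real k * (real (card X) + real (card Y)) / 2)"
        using \<epsilon> by (intro mult_left_mono_neg[OF 2]) auto
      finally show ?thesis by simp
    qed
    also have "- (\<epsilon> * \<delta>\<^sup>2 / 2) * (real k * (real (card X) + real (card Y)) / 2) =
        real (card X) * - (k * \<epsilon> * \<delta>\<^sup>2 / 4) + real (card Y) * - (k * \<epsilon> * \<delta>\<^sup>2 / 4)"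
      by (simp add: field_simps)
    also have "exp \<dots> = r ^ card X * r ^ card Y"
      unfolding r_def exp_add exp_of_nat_mult ..
    finally show ?thesis .
  qed

  txt \<open>Every violated requirement contributes more than 1 to \<open>\<Phi>\<close>, so \<open>\<Phi> w < 1\<close> rules them all out.\<close>
  define \<Phi> where "\<Phi> w = (\<Sum>A\<in>\<A>. f A w) + (\<Sum>X\<in>\<X>. \<Sum>Y\<in>\<X>. g X Y w)" for w
  have "?E \<Phi> = (\<Sum>A\<in>\<A>. ?E (f A)) + (\<Sum>X\<in>\<X>. \<Sum>Y\<in>\<X>. ?E (g X Y))"
    unfolding \<Phi>_def by simp
  also have "(\<Sum>A\<in>\<A>. ?E (f A)) \<le> real (card S) ^ d * (2 ^ k * (1 - p ^ d / 2) ^ (card S - d))"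
  proof -
    have "(card S choose d) * 1 \<le> (card S choose d) * fact d"
      by (intro mult_left_mono) (simp_all add: fact_ge_1)
    also have "\<dots> \<le> card S ^ d" by (rule binomial_fact_pow)
    finally have "card \<A> \<le> card S ^ d"
      using S by (simp add: \<A>_def n_subsets)
    then have "real (card \<A>) \<le> real (card S) ^ d" by (simp flip: of_nat_power)
    moreover have "p ^ d / 2 \<le> 1" using power_le_one[of p d] p by simp
    ultimately show ?thesis by (simp add: Ef mult_right_mono)
  qed
  also have "(\<Sum>X\<in>\<X>. \<Sum>Y\<in>\<X>. ?E (g X Y)) \<le> ((1 + r) ^ card S - 1)\<^sup>2"
  proof -
    \<comment> \<open>Since \<open>k \<ge> 1\<close>, the empty set is not in \<open>\<X>\<close>.
      This is the origin of the \<open>- 1\<close>, without which the bound could not be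
      small.\<close>
    have "(\<Sum>X\<in>\<X>. r ^ card X) \<le> (\<Sum>X\<in>Pow S - {{}}. r ^ card X)"
      using S k by (intro sum_mono2) (auto simp: \<X>_def r_def)
    also have "\<dots> = (\<Sum>X\<in>Pow S. r ^ card X) - 1"
      using S by (subst sum_diff) auto
    also have "(\<Sum>X\<in>Pow S. r ^ card X) = (1 + r) ^ card S"
      using prod_add[OF S, of "\<lambda>_. r" "\<lambda>_. 1"] by (simp add: add.commute)
    finally have "(\<Sum>X\<in>\<X>. r ^ card X)\<^sup>2 \<le> ((1 + r) ^ card S - 1)\<^sup>2"
      by (rule power_mono) (simp add: r_def sum_nonneg)
    moreover have "(\<Sum>X\<in>\<X>. \<Sum>Y\<in>\<X>. ?E (g X Y)) \<le> (\<Sum>X\<in>\<X>. r ^ card X)\<^sup>2"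
      using Eg by (simp add: power2_eq_square sum_product sum_mono)
    ultimately show ?thesis by linarith
  qed
  finally have "?E \<Phi> < 1"
    using small by (simp add: p_def r_def mult.assoc)
  have "\<exists>w. \<Phi> w < 1"
  proof (rule ccontr)
    assume "\<nexists>w. \<Phi> w < 1"
    then have "1 \<le> ?E \<Phi>"
      by (intro measure_pmf.integral_ge_const int) (auto simp: not_less)
    with \<open>?E \<Phi> < 1\<close> show False by simp
  qed
  then obtain w where w: "\<Phi> w < 1" by blast

  have pos: "0 \<le> f A w" "0 \<le> g X Y w" for A X Y
    by (auto simp: f_def g_def intro!: mult_nonneg_nonneg prod_nonneg)
  have f1: "f A w < 1" if "A \<in> \<A>" for A
  proof -
    have "f A w \<le> (\<Sum>A\<in>\<A>. f A w)" using that fin pos by (intro member_le_sum) auto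
    also have "\<dots> \<le> \<Phi> w" using pos by (auto simp: \<Phi>_def intro!: sum_nonneg)
    finally show ?thesis using w by simp
  qed
  have g1: "g X Y w < 1" if "X \<in> \<X>" "Y \<in> \<X>" for X Y
  proof -
    have "g X Y w \<le> (\<Sum>Y\<in>\<X>. g X Y w)"
      using that fin pos by (intro member_le_sum) auto
    also have "\<dots> \<le> (\<Sum>X\<in>\<X>. \<Sum>Y\<in>\<X>. g X Y w)"
      using that fin pos by (intro member_le_sum[of X \<X> "\<lambda>X. \<Sum>Y\<in>\<X>. g X Y w"]) (auto intro!: sum_nonneg)
    also have "\<dots> \<le> \<Phi> w" using pos by (auto simp: \<Phi>_def intro!: sum_nonneg)
    finally show ?thesis using w by simp
  qed
  show ?thesis
  proof (intro exI[of _ "\<lambda>x y. w {x, y}"] conjI allI impI)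
    fix x y show "w {x, y} = w {y, x}" by (simp add: insert_commute)
  next
    fix A assume "A \<subseteq> S" "card A = d"
    then have A: "A \<in> \<A>" by (simp add: \<A>_def)
    let ?Z = "{x \<in> S - A. \<forall>a\<in>A. w {x, a}}"
    have "(\<Prod>x\<in>S - A. 1 - 1 / 2 * of_bool (\<forall>e\<in>(\<lambda>a. {x, a}) ` A. w e)) =
      (\<Prod>x\<in>S - A. if x \<in> ?Z then 1 / 2 else 1 :: real)"
      by (intro prod.cong) auto
    also have "\<dots> = (\<Prod>x\<in>?Z. 1 / 2)"
      using S by (subst prod.If_cases) (auto intro!: arg_cong[of _ _ card] arg_cong2[of _ _ _ _ power])
    finally have "f A w = 2 ^ k * (1 / 2) ^ card ?Z" by (simp add: f_def)
    with f1[OF A] have "(2::real) ^ k < 2 ^ card ?Z" by (simp add: field_simps power_one_over)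
    then have "k < card ?Z" by simp
    also have "card ?Z \<le> card {x \<in> S. \<forall>a\<in>A. w {x, a}}"
      using S by (intro card_mono) auto
    finally show "k \<le> card {x \<in> S. \<forall>a\<in>A. w {x, a}}" by simp
  next
    fix X Y assume "X \<subseteq> S" "Y \<subseteq> S" "k \<le> card X" "k \<le> card Y"
    then have "X \<in> \<X>" "Y \<in> \<X>" by (auto simp: \<X>_def)
    from g1[OF this] have "exp (t * (?e w X Y - \<epsilon> * card X * card Y)) < exp 0"
      by (simp add: g_def algebra_simps exp_add[symmetric] flip: exp_minus exp_add)
    then have "t * (?e w X Y - \<epsilon> * card X * card Y) < 0" by (simp only: exp_less_cancel_iff)
    then show "real (?e w X Y) \<le> \<epsilon> * card X * card Y"
      using t by (simp add: mult_less_0_iff)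
  qed
qed

section \<open>Forgery resistance and the choice of parameters\<close>

definition common_nbrs :: "('a \<Rightarrow> 'a \<Rightarrow> bool) \<Rightarrow> 'a set \<Rightarrow> 'a set \<Rightarrow> 'a set" where
  "common_nbrs R S A = {x \<in> S. \<forall>a\<in>A. R x a}"

text \<open>\<open>A\<close> and \<open>B\<close> play the role of the label sets on the
  neighbourhoods of the two named vertices. Their size is only bounded by \<open>d\<close>, because
  degrees may be smaller and labels may coincide. Nonemptiness lets a partial labeling be extended.
  The density condition bounds the conditional probability of a forgery.\<close>

definition forgery_resistant :: "nat \<Rightarrow> real \<Rightarrow> 'a set \<Rightarrow> ('a \<Rightarrow> 'a \<Rightarrow> bool) \<Rightarrow> bool" where
  "forgery_resistant d \<epsilon> S R \<longleftrightarrow> (\<forall>x y. R x y = R y x) \<and>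
    (\<forall>A\<subseteq>S. card A \<le> d \<longrightarrow> common_nbrs R S A \<noteq> {}) \<and>
    (\<forall>A\<subseteq>S. \<forall>B\<subseteq>S. card A \<le> d \<longrightarrow> card B \<le> d \<longrightarrow>
      real (card {(x, y) \<in> common_nbrs R S A \<times> common_nbrs R S B. R x y}) \<le>
        \<epsilon> * card (common_nbrs R S A) * card (common_nbrs R S B))"

text \<open>With \<delta> of order \<open>1 / d\<close>, lowering the density to \<open>p\<close>
  costs only a constant factor in \<open>p ^ d\<close>. A threshold \<open>k\<close> of order
  \<open>(c + 2) * (d + 1)^2 / \<epsilon>\<close> then makes the density failures rare, and the
  hypothesis says that the number of strings exceeds \<open>k / \<epsilon> ^ d\<close> by a constant
  factor.\<close>

lemma exists_forgery_resistant:
  assumes d: "d \<ge> 1" and \<epsilon>: "0 < \<epsilon>" "\<epsilon> < 1"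
    and c: "216 * (real c + 2) * (real d + 1)\<^sup>2 / \<epsilon> ^ (d + 1) \<le> 2 ^ c"
  shows "\<exists>R. forgery_resistant d \<epsilon> {xs :: bool list. length xs = c} R"
proof -
  define S where "S = {xs :: bool list. length xs = c}"
  \<comment> \<open>Scaled so that \<open>16 * Q * \<epsilon> * \<delta>^2 / 4 = c + 2\<close>.
    Rounding up in \<open>k\<close> costs at most one further \<open>Q\<close>.\<close>
  define Q where "Q = (real c + 2) * (real d + 1)\<^sup>2 / \<epsilon>"
  define k where "k = nat \<lceil>16 * Q\<rceil>"
  define \<delta> where "\<delta> = 1 / (2 * (real d + 1))"
  have S: "finite S" "card S = 2 ^ c"
    using finite_lists_length_eq[of "UNIV :: bool set" c] card_lists_length_eq[of "UNIV :: bool set" c]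
    by (auto simp: S_def)
  have Q0: "(real c + 2) * (real d + 1)\<^sup>2 \<le> Q"
    using \<epsilon> by (simp add: Q_def pos_le_divide_eq mult_left_le)
  have "1 * 1 \<le> (real c + 2) * (real d + 1)\<^sup>2" by (intro mult_mono) (auto simp: one_le_power)
  then have Q1: "1 \<le> Q" using Q0 by simp
  have k: "16 * Q \<le> k" "k \<le> 17 * Q" "k \<ge> 1"
    using Q1 by (auto simp: k_def) linarith+
  have pd: "\<epsilon> ^ d \<le> 1" "0 < \<epsilon> ^ d" using \<epsilon> by (auto simp: power_le_one)
  \<comment> \<open>The constant is \<open>18 * 12\<close>: the exponent
    \<open>d * c + k + 1\<close> is at most \<open>18 * Q\<close>, and \<open>card S - d\<close> and
    \<open>p ^ d / 2\<close> lose the factors 2 and 6.\<close>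
  have N: "216 * Q \<le> 2 ^ c * \<epsilon> ^ d"
    using c \<epsilon> by (simp add: Q_def field_simps)
  have "real d + 1 \<le> Q"
  proof -
    have "1 * (real d + 1) \<le> (real c + 2) * (real d + 1)\<^sup>2"
      by (intro mult_mono) (auto simp: power2_eq_square)
    then show ?thesis using Q0 by simp
  qed
  moreover have "(2::real) ^ c * \<epsilon> ^ d \<le> 2 ^ c" using pd by simp
  ultimately have Nd: "2 * real d \<le> 2 ^ c" using N Q1 by linarith
  then have dS: "d \<le> card S"
    using S by (metis (mono_tags) add_leE mult_2 of_nat_le_iff of_nat_mult of_nat_numeral of_nat_power)
  have half: "2 ^ c / 2 \<le> real (card S - d)"
    using Nd dS S by (simp add: of_nat_diff)
  have \<delta>: "0 < \<delta>" "\<delta> \<le> 1 / 2" by (auto simp: \<delta>_def field_simps)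
  define p where "p = \<epsilon> * (1 - 2 * \<delta>)"
  have p: "0 \<le> p" "p \<le> 1" using \<epsilon> \<delta> by (auto simp: p_def intro!: mult_le_one)
  have p3: "\<epsilon> ^ d / 3 \<le> p ^ d"
  proof -
    \<comment> \<open>The choice of \<delta> makes the loss in \<open>p ^ d\<close> equal to
      \<open>(1 + 1 / d) ^ d\<close>, which is at most \<open>exp 1\<close>.\<close>
    have "1 - 2 * \<delta> = 1 / (1 + 1 / real d)" using d by (simp add: \<delta>_def field_simps)
    then have "p ^ d = \<epsilon> ^ d / (1 + 1 / real d) ^ d" by (simp add: p_def power_mult_distrib power_divide)
    moreover have "(1 + 1 / real d) ^ d \<le> 3"
      using exp_ge_one_plus_x_over_n_power_n[of d 1] d exp_le by simp
    ultimately show ?thesis using pd d by (simp only:) (intro frac_le, auto simp: add_pos_nonneg)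
  qed
  have term1: "real (card S) ^ d * 2 ^ k * (1 - p ^ d / 2) ^ (card S - d) \<le> 1 / 2"
  proof -
    have "(1 - p ^ d / 2) ^ (card S - d) \<le> exp (- (p ^ d / 2)) ^ (card S - d)"
      using p power_le_one[of p d] exp_ge_add_one_self[of "- (p ^ d / 2)"]
      by (intro power_mono) auto
    also have "\<dots> = exp (- (real (card S - d) * (p ^ d / 2)))"
      by (simp flip: exp_of_nat_mult)
    \<comment> \<open>The summands \<open>d * c\<close> and \<open>k\<close> of the exponent cancel
      the factors \<open>card S ^ d\<close> and \<open>2 ^ k\<close>; the extra 1 leaves
      \<open>1 / 2\<close>.\<close>
    also have "\<dots> \<le> exp (- real (d * c + k + 1))"
    proof -
      have "real (d * c + 1) \<le> (real c + 2) * (real d + 1)\<^sup>2"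
        by (simp add: power2_eq_square algebra_simps)
      then have "real (d * c + k + 1) \<le> 18 * Q" using Q0 k by simp
      also have "\<dots> \<le> 2 ^ c / 2 * (\<epsilon> ^ d / 3 / 2)" using N by simp
      also have "\<dots> \<le> real (card S - d) * (p ^ d / 2)"
        using half p3 pd by (intro mult_mono) auto
      finally show ?thesis by simp
    qed
    also have "\<dots> = exp (- 1) ^ (d * c + k + 1)"
      by (subst exp_of_nat_mult[symmetric]) simp
    also have "\<dots> \<le> (1 / 2) ^ (d * c + k + 1)"
      using exp_ge_add_one_self[of 1] by (intro power_mono) (auto simp: exp_minus field_simps)
    finally have "real (card S) ^ d * 2 ^ k * (1 - p ^ d / 2) ^ (card S - d) \<le>
        real (card S) ^ d * 2 ^ k * (1 / 2) ^ (d * c + k + 1)"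
      by (intro mult_left_mono) auto
    also have "\<dots> = 1 / 2"
      using S by (simp add: power_add power_one_over field_simps flip: power_mult)
    finally show ?thesis .
  qed
  define r where "r = exp (- (k * \<epsilon> * \<delta>\<^sup>2 / 4))"
  have term2: "((1 + r) ^ card S - 1)\<^sup>2 \<le> (5 / 16)\<^sup>2"
  proof -
    have "real (c + 2) = 16 * Q * \<epsilon> * \<delta>\<^sup>2 / 4"
    proof -
      have "Q * \<epsilon> = (real c + 2) * (real d + 1)\<^sup>2" using \<epsilon> by (simp add: Q_def)
      moreover have "(real d + 1)\<^sup>2 * \<delta>\<^sup>2 = 1 / 4"
      proof -
        have "(real d + 1) * \<delta> = 1 / 2" by (simp add: \<delta>_def divide_simps)
        then have "((real d + 1) * \<delta>)\<^sup>2 = (1 / 2)\<^sup>2" by (simp only:)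
        then show ?thesis by (simp add: power_mult_distrib power_divide)
      qed
      ultimately have "Q * \<epsilon> * \<delta>\<^sup>2 = (real c + 2) / 4" by (simp add: mult.assoc)
      then show ?thesis by simp
    qed
    also have "\<dots> \<le> k * \<epsilon> * \<delta>\<^sup>2 / 4"
      using k \<epsilon> by (intro divide_right_mono mult_right_mono) auto
    finally have "r \<le> exp (- real (c + 2))" by (simp add: r_def)
    also have "\<dots> = exp (- 1) ^ (c + 2)"
      by (subst exp_of_nat_mult[symmetric]) simp
    also have "\<dots> \<le> (1 / 2) ^ (c + 2)"
      using exp_ge_add_one_self[of 1] by (intro power_mono) (auto simp: exp_minus field_simps)
    also have "\<dots> = 1 / (4 * real (card S))" using S by (simp add: power_one_over)
    finally have r: "r * real (card S) \<le> 1 / 4" using S by (simp add: field_simps)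
    have "(1 + r) ^ card S \<le> exp r ^ card S"
      by (intro power_mono) (auto simp: r_def)
    also have "\<dots> = exp (r * card S)" by (simp flip: exp_of_nat_mult add: mult.commute)
    also have "\<dots> \<le> exp (1 / 4)" using r by simp
    \<comment> \<open>From \<open>exp x \<le> 1 + x + x^2\<close> at
      \<open>x = 1 / 4\<close>.\<close>
    also have "\<dots> \<le> 1 + 5 / 16" using exp_bound[of "1 / 4"] by (simp add: power2_eq_square)
    finally have "(1 + r) ^ card S \<le> 1 + 5 / 16" .
    moreover have "1 \<le> (1 + r) ^ card S" by (simp add: r_def one_le_power)
    ultimately show ?thesis by (intro power_mono) auto
  qed
  have "real (card S) ^ d * 2 ^ k * (1 - (\<epsilon> * (1 - 2 * \<delta>)) ^ d / 2) ^ (card S - d) +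
      ((1 + exp (- (k * \<epsilon> * \<delta>\<^sup>2 / 4))) ^ card S - 1)\<^sup>2 < 1"
    using term1 term2 by (simp add: p_def r_def power2_eq_square)
  from exists_quasirandom_relation[OF S(1) k(3) \<epsilon>(1) less_imp_le[OF \<epsilon>(2)] \<delta> this]
  obtain R where R: "\<forall>x y. R x y = R y x"
    "\<forall>A\<subseteq>S. card A = d \<longrightarrow> k \<le> card {x \<in> S. \<forall>a\<in>A. R x a}"
    "\<forall>X\<subseteq>S. \<forall>Y\<subseteq>S. k \<le> card X \<longrightarrow> k \<le> card Y \<longrightarrow>
      real (card {(x, y) \<in> X \<times> Y. R x y}) \<le> \<epsilon> * card X * card Y"
    by (elim exE conjE)
  have large: "k \<le> card (common_nbrs R S A)" if A: "A \<subseteq> S" "card A \<le> d" for A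
  proof -
    \<comment> \<open>Enlarging \<open>A\<close> to exactly \<open>d\<close> elements can only
      shrink its common neighbourhood.\<close>
    obtain A' where A': "A \<subseteq> A'" "A' \<subseteq> S" "card A' = d"
      using exists_subset_between[of A d S] A dS S by blast
    have "k \<le> card (common_nbrs R S A')" using R(2) A' by (simp add: common_nbrs_def)
    also have "\<dots> \<le> card (common_nbrs R S A)"
      using A' S by (intro card_mono) (auto simp: common_nbrs_def)
    finally show ?thesis .
  qed
  have "forgery_resistant d \<epsilon> S R"
    unfolding forgery_resistant_def
  proof (intro conjI allI impI)
    show "common_nbrs R S A \<noteq> {}" if "A \<subseteq> S" "card A \<le> d" for A
      using large[OF that] k(3) by auto
    show "real (card {(x, y) \<in> common_nbrs R S A \<times> common_nbrs R S B. R x y}) \<le>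
        \<epsilon> * card (common_nbrs R S A) * card (common_nbrs R S B)"
      if "A \<subseteq> S" "B \<subseteq> S" "card A \<le> d" "card B \<le> d" for A B
      using that large by (intro R(3)[rule_format]) (auto simp: common_nbrs_def)
  qed (use R(1) in blast)
  then show ?thesis by (auto simp: S_def)
qed

text \<open>In a graph of maximal degree 0 there is no edge to accept, so the empty label and the
  decoder that rejects everything suffice.\<close>

lemma forgery_resistant_zero:
  assumes "0 \<le> \<epsilon>"
  shows "forgery_resistant 0 \<epsilon> {[]} (\<lambda>_ _. False)"
  using assms by (auto simp: forgery_resistant_def common_nbrs_def subset_singleton_iff)

section \<open>The game\<close>

text \<open>The homomorphisms from \<open>G\<close> into the relation \<open>D\<close> on
  \<open>S\<close>. Extensionality fixes the values off the vertices, which keeps the set finite and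
  allows a uniform distribution on it.\<close>

definition valid_labelings :: "label set \<Rightarrow> decoder \<Rightarrow> sgraph \<Rightarrow> labeling set" where
  "valid_labelings S D G = {l \<in> pverts G \<rightarrow>\<^sub>E S. \<forall>(u, v)\<in>parcs G. D (l u) (l v)}"

definition nbhd :: "sgraph \<Rightarrow> nat \<Rightarrow> nat set" where
  "nbhd G v = {w. (v, w) \<in> parcs G}"

lemma max_degree_graphsD:
  assumes "G \<in> max_degree_graphs d"
  shows "finite (pverts G)" "(u, v) \<in> parcs G \<Longrightarrow> (v, u) \<in> parcs G" "(v, v) \<notin> parcs G"
    "(u, v) \<in> parcs G \<Longrightarrow> u \<in> pverts G \<and> v \<in> pverts G"
    "v \<in> pverts G \<Longrightarrow> card (nbhd G v) \<le> d" "finite (nbhd G v)"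
proof -
  interpret pair_graph G using assms by (simp add: max_degree_graphs_def)
  show "finite (pverts G)" by (rule pair_finite_verts)
  show "(v, u) \<in> parcs G" if "(u, v) \<in> parcs G"
    using pair_sym_arcs that by (auto simp: symmetric_def dest: symD)
  show "(v, v) \<notin> parcs G" using pair_no_loops by fastforce
  show "u \<in> pverts G \<and> v \<in> pverts G" if "(u, v) \<in> parcs G"
    using that wellformed' by blast
  have nb: "nbhd G v = snd ` out_arcs (with_proj G) v"
    by (force simp: nbhd_def out_arcs_def)
  have fin: "finite (out_arcs (with_proj G) v)"
    using pair_finite_arcs by (simp add: out_arcs_def)
  then show "finite (nbhd G v)" by (simp add: nb)
  show "card (nbhd G v) \<le> d" if "v \<in> pverts G"
    using assms that card_image_le[OF fin, of snd]
    by (fastforce simp: nb max_degree_graphs_def out_degree_def)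
qed

context
  fixes d :: nat and \<epsilon> :: real and S :: "label set" and D :: decoder and G :: sgraph
  assumes R: "forgery_resistant d \<epsilon> S D" and G: "G \<in> max_degree_graphs d" and S: "finite S"
begin

abbreviation (input) "\<L> \<equiv> valid_labelings S D G"

lemma decoder_sym: "D x y = D y x"
  using R by (simp add: forgery_resistant_def)

lemma finite_valid_labelings: "finite \<L>"
proof (rule finite_subset)
  show "\<L> \<subseteq> pverts G \<rightarrow>\<^sub>E S" by (auto simp: valid_labelings_def)
qed (use S max_degree_graphsD(1)[OF G] in \<open>auto intro: finite_PiE\<close>)

text \<open>Greedy labeling: the neighbours already labeled carry at most \<open>d\<close> labels,
  and any common neighbour of these can be given to the next vertex.\<close>

lemma valid_labelings_nonempty: "\<L> \<noteq> {}"
proof -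
  have "\<exists>l. (\<forall>v\<in>W. l v \<in> S) \<and> (\<forall>u\<in>W. \<forall>v\<in>W. (u, v) \<in> parcs G \<longrightarrow> D (l u) (l v))"
    if "W \<subseteq> pverts G" for W
  proof -
    have "finite W" using that max_degree_graphsD(1)[OF G] finite_subset by blast
    then show ?thesis using that
    proof (induction W rule: finite_induct)
      case (insert v W)
      then obtain l where l: "\<And>v. v \<in> W \<Longrightarrow> l v \<in> S"
        "\<And>u v. u \<in> W \<Longrightarrow> v \<in> W \<Longrightarrow> (u, v) \<in> parcs G \<Longrightarrow> D (l u) (l v)"
        by (metis insert_subset)
      let ?A = "l ` (nbhd G v \<inter> W)"
      have "card ?A \<le> card (nbhd G v \<inter> W)" using insert.hyps by (intro card_image_le) auto
      also have "\<dots> \<le> card (nbhd G v)"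
        using max_degree_graphsD(6)[OF G] by (intro card_mono) auto
      also have "\<dots> \<le> d" using max_degree_graphsD(5)[OF G] insert.prems by simp
      finally have "common_nbrs D S ?A \<noteq> {}"
        using R l(1) unfolding forgery_resistant_def by (metis Int_iff image_subsetI)
      then obtain x where x: "x \<in> S" "\<And>w. w \<in> W \<Longrightarrow> (v, w) \<in> parcs G \<Longrightarrow> D x (l w)"
        by (auto simp: common_nbrs_def nbhd_def)
      show ?case
        using l x insert.hyps max_degree_graphsD(2,3)[OF G] decoder_sym
        by (intro exI[of _ "l(v := x)"]) auto
    qed auto
  qed
  from this[of "pverts G"] obtain l where l: "\<forall>v\<in>pverts G. l v \<in> S"
    "\<forall>u\<in>pverts G. \<forall>v\<in>pverts G. (u, v) \<in> parcs G \<longrightarrow> D (l u) (l v)" by blast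
  then have "restrict l (pverts G) \<in> \<L>"
    using max_degree_graphsD(4)[OF G] by (auto simp: valid_labelings_def)
  then show ?thesis by blast
qed

text \<open>
  Once all labels except those of two non-adjacent vertices are fixed, these two range
  independently over the common neighbourhoods of the labels around them.
\<close>

lemma bij_betw_fiber:
  assumes l0: "l0 \<in> \<L>" and uv: "u \<in> pverts G" "v \<in> pverts G" "u \<noteq> v" "(u, v) \<notin> parcs G"
  shows "bij_betw (\<lambda>l. (l u, l v)) {l \<in> \<L>. \<forall>x. x \<noteq> u \<longrightarrow> x \<noteq> v \<longrightarrow> l x = l0 x}
    (common_nbrs D S (l0 ` nbhd G u) \<times> common_nbrs D S (l0 ` nbhd G v))"
proof (rule bij_betw_byWitness[where f' = "\<lambda>(a, b). l0(u := a, v := b)"])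
  have vu: "(v, u) \<notin> parcs G" using uv max_degree_graphsD(2)[OF G] by blast
  show "\<forall>l\<in>{l \<in> \<L>. \<forall>x. x \<noteq> u \<longrightarrow> x \<noteq> v \<longrightarrow> l x = l0 x}.
      (\<lambda>(a, b). l0(u := a, v := b)) (l u, l v) = l"
    by (auto simp: fun_eq_iff)
  show "\<forall>q\<in>common_nbrs D S (l0 ` nbhd G u) \<times> common_nbrs D S (l0 ` nbhd G v).
      (\<lambda>l. (l u, l v)) ((\<lambda>(a, b). l0(u := a, v := b)) q) = q"
    using uv by auto
  show "(\<lambda>l. (l u, l v)) ` {l \<in> \<L>. \<forall>x. x \<noteq> u \<longrightarrow> x \<noteq> v \<longrightarrow> l x = l0 x} \<subseteq>
      common_nbrs D S (l0 ` nbhd G u) \<times> common_nbrs D S (l0 ` nbhd G v)"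
  proof clarify
    fix l assume l: "l \<in> \<L>" "\<forall>x. x \<noteq> u \<longrightarrow> x \<noteq> v \<longrightarrow> l x = l0 x"
    \<comment> \<open>As \<open>u\<close> and \<open>v\<close> are not adjacent, neither lies in the
      neighbourhood of the other, so both neighbourhoods keep their labels from
      \<open>l0\<close>.\<close>
    have "l0 w = l w" if "(u, w) \<in> parcs G \<or> (v, w) \<in> parcs G" for w
    proof -
      have "w \<noteq> u" "w \<noteq> v" using that uv(4) vu max_degree_graphsD(3)[OF G] by auto
      then show ?thesis using l(2) by simp
    qed
    then show "l u \<in> common_nbrs D S (l0 ` nbhd G u) \<and> l v \<in> common_nbrs D S (l0 ` nbhd G v)"
      using l(1) uv by (auto simp: common_nbrs_def nbhd_def valid_labelings_def PiE_iff)
  qed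
  show "(\<lambda>(a, b). l0(u := a, v := b)) ` (common_nbrs D S (l0 ` nbhd G u) \<times> common_nbrs D S (l0 ` nbhd G v))
      \<subseteq> {l \<in> \<L>. \<forall>x. x \<noteq> u \<longrightarrow> x \<noteq> v \<longrightarrow> l x = l0 x}"
  proof clarify
    fix a b assume ab: "a \<in> common_nbrs D S (l0 ` nbhd G u)" "b \<in> common_nbrs D S (l0 ` nbhd G v)"
    let ?l = "l0(u := a, v := b)"
    have "D (?l x) (?l y)" if xy: "(x, y) \<in> parcs G" for x y
    proof -
      have "(y, x) \<in> parcs G" "x \<noteq> y" using xy max_degree_graphsD(2,3)[OF G] by blast+
      moreover have "D (l0 x) (l0 y)" using l0 xy by (auto simp: valid_labelings_def)
      ultimately show ?thesis
        using ab xy uv vu decoder_sym[of "l0 x"] by (auto simp: common_nbrs_def nbhd_def)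
    qed
    then have "\<forall>(x, y)\<in>parcs G. D (?l x) (?l y)" by blast
    moreover have "?l \<in> pverts G \<rightarrow>\<^sub>E S"
      using ab l0 uv by (auto simp: valid_labelings_def common_nbrs_def PiE_iff extensional_def)
    ultimately show "?l \<in> \<L> \<and> (\<forall>x. x \<noteq> u \<longrightarrow> x \<noteq> v \<longrightarrow> ?l x = l0 x)"
      by (simp add: valid_labelings_def)
  qed
qed

text \<open>The bijection turns the sum into the number of related pairs minus \<epsilon> times the
  number of all pairs. Subtracting \<epsilon> in each summand, rather than dividing, makes the bound
  additive over disjoint sets of labelings.\<close>

lemma fiber_win_le:
  assumes l0: "l0 \<in> \<L>" and uv: "u \<in> pverts G" "v \<in> pverts G" "u \<noteq> v" "(u, v) \<notin> parcs G"
  defines "F \<equiv> {l \<in> \<L>. \<forall>x. x \<noteq> u \<longrightarrow> x \<noteq> v \<longrightarrow> l x = l0 x}"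
  shows "(\<Sum>l\<in>F. of_bool (D (l u) (l v)) - \<epsilon>) \<le> 0"
proof -
  let ?X = "common_nbrs D S (l0 ` nbhd G u)" and ?Y = "common_nbrs D S (l0 ` nbhd G v)"
  have fin: "finite (?X \<times> ?Y)" using S by (auto simp: common_nbrs_def)
  have nb: "l0 ` nbhd G w \<subseteq> S \<and> card (l0 ` nbhd G w) \<le> d" if "w \<in> pverts G" for w
  proof -
    have "card (l0 ` nbhd G w) \<le> card (nbhd G w)"
      using max_degree_graphsD(6)[OF G] by (rule card_image_le)
    moreover have "l0 ` nbhd G w \<subseteq> S"
      using l0 max_degree_graphsD(4)[OF G] by (fastforce simp: valid_labelings_def nbhd_def PiE_iff)
    ultimately show ?thesis using max_degree_graphsD(5)[OF G that] by simp
  qed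
  have "(\<Sum>l\<in>F. of_bool (D (l u) (l v)) - \<epsilon>) = (\<Sum>q\<in>?X \<times> ?Y. of_bool (D (fst q) (snd q)) - \<epsilon>)"
    using sum.reindex_bij_betw[OF bij_betw_fiber[OF l0 uv],
        of "\<lambda>q. of_bool (D (fst q) (snd q)) - \<epsilon>"]
    by (simp add: F_def)
  also have "\<dots> = real (card {(x, y) \<in> ?X \<times> ?Y. D x y}) - \<epsilon> * card ?X * card ?Y"
    using fin by (simp add: sum_subtractf sum_of_bool_eq card_cartesian_product case_prod_unfold Int_def mem_Times_iff
        conj_assoc)
  also have "\<dots> \<le> 0"
    using R nb[OF uv(1)] nb[OF uv(2)] by (simp add: forgery_resistant_def)
  finally show ?thesis .
qed

section \<open>Induction over the decision tree of the adversary\<close>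

definition wins :: "labeling \<Rightarrow> adversary \<Rightarrow> bool" where
  "wins l A \<longleftrightarrow> (case named_pair l A of (u, v) \<Rightarrow> (u, v) \<notin> parcs G \<and> D (l u) (l v))"

text \<open>
  \<open>K\<close> is the set of labelings consistent with the answers seen so far: membership in it does not
  depend on the labels of the unqueried vertices \<open>U\<close>.
\<close>

lemma sum_wins_le:
  assumes "legal A U" "U \<subseteq> pverts G" "K \<subseteq> \<L>"
    and "\<And>l l'. l \<in> K \<Longrightarrow> l' \<in> \<L> \<Longrightarrow> (\<And>x. x \<notin> U \<Longrightarrow> l' x = l x) \<Longrightarrow> l' \<in> K"
    and "0 \<le> \<epsilon>"
  shows "(\<Sum>l\<in>K. of_bool (wins l A) - \<epsilon>) \<le> 0"
  using assms
proof (induction A arbitrary: U K)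
  case (Name u v)
  have uv: "u \<in> pverts G" "v \<in> pverts G" "u \<noteq> v" "u \<in> U" "v \<in> U" using Name by auto
  have finK: "finite K" using Name.prems(3) finite_valid_labelings finite_subset by blast
  show ?case
  proof (cases "(u, v) \<in> parcs G")
    case True
    \<comment> \<open>Naming an edge never wins, so every summand is
      \<open>- \<epsilon>\<close>.\<close>
    then show ?thesis using Name.prems(5) by (simp add: wins_def)
  next
    case False
    \<comment> \<open>Erasing the two named labels; the placeholder \<open>[]\<close> is arbitrary.
      The fibres are the classes of labelings that agree off \<open>u\<close> and
      \<open>v\<close>.\<close>
    define \<rho> where "\<rho> l = l(u := [], v := [])" for l :: labeling
    have fib: "(\<Sum>l\<in>{l \<in> K. \<rho> l = m}. of_bool (wins l (Name u v)) - \<epsilon>) \<le> 0" if m: "m \<in> \<rho> ` K" for m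
    proof -
      obtain l0 where l0: "l0 \<in> K" "m = \<rho> l0" using m by blast
      have eq: "\<rho> l = \<rho> l0 \<longleftrightarrow> (\<forall>x. x \<noteq> u \<longrightarrow> x \<noteq> v \<longrightarrow> l x = l0 x)" for l
        by (auto simp: \<rho>_def fun_eq_iff)
      have "{l \<in> K. \<rho> l = m} = {l \<in> \<L>. \<forall>x. x \<noteq> u \<longrightarrow> x \<noteq> v \<longrightarrow> l x = l0 x}"
        unfolding l0(2) eq
      proof (intro Collect_cong iffI)
        fix l assume *: "l \<in> \<L> \<and> (\<forall>x. x \<noteq> u \<longrightarrow> x \<noteq> v \<longrightarrow> l x = l0 x)"
        \<comment> \<open>Because \<open>u\<close> and \<open>v\<close> are unqueried,
          \<open>K\<close> contains every valid labeling that differs from \<open>l0\<close> only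
          there, so the whole fibre lies in \<open>K\<close>.\<close>
        have "l \<in> K" by (rule Name.prems(4)[OF l0(1)]) (use * uv in auto)
        with * show "l \<in> K \<and> (\<forall>x. x \<noteq> u \<longrightarrow> x \<noteq> v \<longrightarrow> l x = l0 x)" by simp
      qed (use Name.prems(3) in auto)
      then show ?thesis
        using fiber_win_le[of l0 u v] l0 Name.prems(3) uv False by (auto simp: wins_def)
    qed
    show ?thesis unfolding sum.image_gen[OF finK, of _ \<rho>] by (rule sum_nonpos) (rule fib)
  qed
next
  case (Query x f)
  have finK: "finite K" using Query.prems(3) finite_valid_labelings finite_subset by blast
  \<comment> \<open>Splitting by the answer \<open>a\<close> fixes the continuation
    \<open>f a\<close>. The part of \<open>K\<close> with this answer is closed under changes on
    \<open>U - {x}\<close>.\<close>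
  have fib: "(\<Sum>l\<in>{l \<in> K. l x = a}. of_bool (wins l (Query x f)) - \<epsilon>) \<le> 0" for a
  proof -
    have "(\<Sum>l\<in>{l \<in> K. l x = a}. of_bool (wins l (Query x f)) - \<epsilon>) =
        (\<Sum>l\<in>{l \<in> K. l x = a}. of_bool (wins l (f a)) - \<epsilon>)"
      by (intro sum.cong) (auto simp: wins_def)
    also have "\<dots> \<le> 0"
    proof (rule Query.IH)
      show "legal (f a) (U - {x})" using Query.prems(1) by simp
      fix l l' assume l: "l \<in> {l \<in> K. l x = a}" "l' \<in> \<L>" "\<And>y. y \<notin> U - {x} \<Longrightarrow> l' y = l y"
      then have "l' \<in> K" by (intro Query.prems(4)[of l l']) auto
      then show "l' \<in> {l \<in> K. l x = a}" using l by auto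
    qed (use Query.prems in auto)
    finally show ?thesis .
  qed
  show ?case unfolding sum.image_gen[OF finK, of _ "\<lambda>l. l x"] by (rule sum_nonpos) (rule fib)
qed

text \<open>Before the first query all valid labelings are consistent, so the summed bound applies
  to the whole of \<open>\<L>\<close>; dividing by its cardinality gives the probability.\<close>

lemma win_prob_le:
  assumes A: "legal A (pverts G)" and \<epsilon>: "0 \<le> \<epsilon>" and E: "E G = pmf_of_set \<L>"
  shows "win_prob E D G A \<le> \<epsilon>"
proof -
  have "(\<Sum>l\<in>\<L>. of_bool (wins l A) - \<epsilon>) \<le> 0"
    by (rule sum_wins_le[OF A]) (use \<epsilon> in auto)
  then have "real (card (\<L> \<inter> {l. wins l A})) \<le> card \<L> * \<epsilon>"
    using finite_valid_labelings by (simp add: sum_subtractf sum_of_bool_eq)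
  moreover have "card \<L> > 0"
    using finite_valid_labelings valid_labelings_nonempty by (simp add: card_gt_0_iff)
  ultimately show ?thesis
    using finite_valid_labelings valid_labelings_nonempty
    by (simp add: win_prob_def E measure_pmf_of_set wins_def[symmetric] field_simps)
qed

end

lemma labeling_scheme_of_forgery_resistant:
  assumes R: "forgery_resistant d \<epsilon> {xs :: label. length xs = c} D" and \<epsilon>: "0 \<le> \<epsilon>"
  shows "\<exists>E D. labeling_scheme (max_degree_graphs d) c E D \<and>
    (\<forall>n\<ge>2. forgery_prob (max_degree_graphs d) E D n \<le> \<epsilon>)"
proof -
  define S :: "label set" where "S = {xs. length xs = c}"
  define E where "E G = pmf_of_set (valid_labelings S D G)" for G
  have S: "finite S" "forgery_resistant d \<epsilon> S D"
    using finite_lists_length_eq[of "UNIV :: bool set" c] R by (auto simp: S_def)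
  have "labeling_scheme (max_degree_graphs d) c E D"
    unfolding labeling_scheme_def
  proof (intro ballI)
    fix G l assume G: "G \<in> max_degree_graphs d" and l: "l \<in> set_pmf (E G)"
    have "l \<in> valid_labelings S D G"
      using l finite_valid_labelings[OF S(2) G S(1)] valid_labelings_nonempty[OF S(2) G S(1)]
      by (simp add: E_def)
    then show "(\<forall>v\<in>pverts G. length (l v) = c) \<and> (\<forall>(u, v)\<in>parcs G. D (l u) (l v))"
      by (auto simp: valid_labelings_def S_def PiE_iff)
  qed
  moreover have "forgery_prob (max_degree_graphs d) E D n \<le> \<epsilon>" if n: "n \<ge> 2" for n
    unfolding forgery_prob_def
  proof (rule cSUP_least)
    \<comment> \<open>The edgeless graph on \<open>n \<ge> 2\<close> vertices admits a legal play,
      so the supremum is over a nonempty set.\<close>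
    define G :: sgraph where "G = \<lparr>pverts = {..<n}, parcs = {}\<rparr>"
    have "pair_graph G" by unfold_locales (auto simp: G_def symmetric_def sym_def)
    then have "G \<in> max_degree_graphs d"
      by (simp add: max_degree_graphs_def G_def out_degree_def out_arcs_def)
    then have "(G, Name 0 1) \<in> {(G, A). G \<in> max_degree_graphs d \<and> card (pverts G) = n \<and> legal A (pverts G)}"
      using n by (simp add: G_def)
    then show "{(G, A). G \<in> max_degree_graphs d \<and> card (pverts G) = n \<and> legal A (pverts G)} \<noteq> {}"
      by blast
  qed (auto simp: E_def intro!: win_prob_le[OF S(2) _ S(1) _ \<epsilon>])
  ultimately show ?thesis by blast
qed

section \<open>Label size\<close>

text \<open>The base-2 logarithm of \<open>4096 * W ^ 3\<close>, where
  \<open>W = (d + 1) * (log 2 (1 / \<epsilon>) + 1)\<close>. It pays for the factor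
  \<open>216 * (c + 2) * (d + 1)^2\<close> in the existence condition.\<close>

definition slack :: "nat \<Rightarrow> real \<Rightarrow> real" where
  "slack d \<epsilon> = 3 * log 2 ((real d + 1) * (log 2 (1 / \<epsilon>) + 1)) + 12"

text \<open>At \<open>d = 0\<close> the slack is dropped, since the formula
  \<open>2 * d * log 2 (1 / \<epsilon>) * (1 + g)\<close> is 0 there for every
  \<open>g\<close>.\<close>

definition label_size :: "nat \<Rightarrow> real \<Rightarrow> nat" where
  "label_size d \<epsilon> = (if d = 0 then 0 else nat \<lceil>2 * real d * log 2 (1 / \<epsilon>) + slack d \<epsilon>\<rceil>)"

text \<open>At \<open>d = 0\<close> the junk value of the quotient would make this \<open>-1\<close> and break uniformity in \<open>d\<close>.\<close>

definition rel_excess :: "nat \<Rightarrow> real \<Rightarrow> real" where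
  "rel_excess d \<epsilon> = (if d = 0 then 0 else real (label_size d \<epsilon>) / (2 * real d * log 2 (1 / \<epsilon>)) - 1)"

lemma label_size_bounds:
  assumes "d \<ge> 1" "0 < \<epsilon>" "\<epsilon> < 1"
  shows "2 * real d * log 2 (1 / \<epsilon>) + slack d \<epsilon> \<le> label_size d \<epsilon>"
    "label_size d \<epsilon> \<le> 2 * real d * log 2 (1 / \<epsilon>) + slack d \<epsilon> + 1" "12 \<le> slack d \<epsilon>"
proof -
  have L: "0 < log 2 (1 / \<epsilon>)" using assms by simp
  have "1 * 1 \<le> (real d + 1) * (log 2 (1 / \<epsilon>) + 1)"
    using L by (intro mult_mono) auto
  then show s: "12 \<le> slack d \<epsilon>" by (simp add: slack_def)
  have "0 \<le> 2 * real d * log 2 (1 / \<epsilon>) + slack d \<epsilon>" using s L by simp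
  then show "2 * real d * log 2 (1 / \<epsilon>) + slack d \<epsilon> \<le> label_size d \<epsilon>"
    "label_size d \<epsilon> \<le> 2 * real d * log 2 (1 / \<epsilon>) + slack d \<epsilon> + 1"
    using assms by (auto simp: label_size_def)
qed

text \<open>The size occurs on both sides, but only linearly on the left, where it is at most a
  constant times \<open>W\<close>. The polynomial factor is thus of order \<open>W ^ 3\<close>, and
  the power of \<open>1 / \<epsilon>\<close> is covered because
  \<open>d + 1 \<le> 2 * d\<close>.\<close>

lemma label_size_sufficient:
  assumes d: "d \<ge> 1" and \<epsilon>: "0 < \<epsilon>" "\<epsilon> < 1"
  shows "216 * (real (label_size d \<epsilon>) + 2) * (real d + 1)\<^sup>2 / \<epsilon> ^ (d + 1) \<le> 2 ^ label_size d \<epsilon>"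
proof -
  define L where "L = log 2 (1 / \<epsilon>)"
  define W where "W = (real d + 1) * (L + 1)"
  define c where "c = label_size d \<epsilon>"
  have L: "0 < L" using \<epsilon> by (simp add: L_def)
  have "2 * 1 \<le> W" using d L unfolding W_def by (intro mult_mono) auto
  then have W: "2 \<le> W" by simp
  have dW: "real d + 1 \<le> W" "2 * real d * L \<le> 2 * W"
    using d L by (auto simp: W_def algebra_simps)
  have lW: "log 2 W \<le> W"
  proof -
    have "ln W \<le> W / 2 - 1 + ln 2" using ln_le_minus_one[of "W / 2"] W by (simp add: ln_div)
    also have "\<dots> \<le> W / 2" using ln_2_less_1 by simp
    also have "\<dots> \<le> W * ln 2" using ln2_ge_two_thirds W mult_left_mono[of "1 / 2" "ln 2" W] by simp
    finally show ?thesis by (simp add: log_def field_simps)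
  qed
  have s: "slack d \<epsilon> = 3 * log 2 W + 12" by (simp add: slack_def W_def L_def)
  have "real c + 2 \<le> 2 * real d * L + (3 * log 2 W + 12) + 3"
    using label_size_bounds(2)[OF d \<epsilon>] s by (simp add: c_def L_def)
  \<comment> \<open>The terms give \<open>2 * W + 3 * W + 15\<close>, and \<open>W \<ge> 2\<close>
    turns 15 into \<open>15 / 2 * W\<close>.\<close>
  also have "\<dots> \<le> 25 / 2 * W" using dW lW W by linarith
  finally have c2: "real c + 2 \<le> 25 / 2 * W" .
  have eps: "1 / \<epsilon> ^ (d + 1) = 2 powr (L * real (d + 1))"
  proof -
    have "2 powr (L * real (d + 1)) = (2 powr L) powr real (d + 1)" by (rule powr_powr[symmetric])
    also have "2 powr L = 1 / \<epsilon>" using \<epsilon> by (simp add: L_def)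
    also have "(1 / \<epsilon>) powr real (d + 1) = (1 / \<epsilon>) ^ (d + 1)" using \<epsilon> by (intro powr_realpow) simp
    finally show ?thesis by (simp add: power_one_over)
  qed
  have "216 * (real c + 2) * (real d + 1)\<^sup>2 / \<epsilon> ^ (d + 1) =
      216 * (real c + 2) * (real d + 1)\<^sup>2 * 2 powr (L * real (d + 1))"
    using eps by (simp add: divide_inverse)
  also have "\<dots> \<le> 216 * (25 / 2 * W) * W\<^sup>2 * 2 powr (2 * real d * L)"
  proof (intro mult_mono power_mono)
    have "real (d + 1) \<le> 2 * real d" using d by simp
    then show "2 powr (L * real (d + 1)) \<le> 2 powr (2 * real d * L)"
      using L by (intro powr_mono) (auto simp: mult.commute)
  qed (use c2 dW W in auto)
  \<comment> \<open>The constant \<open>216 * 25 / 2 = 2700\<close> is rounded up to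
    \<open>2 ^ 12\<close>, the 12 in \<open>slack\<close>.\<close>
  also have "\<dots> \<le> 4096 * W ^ 3 * 2 powr (2 * real d * L)"
    using W by (intro mult_right_mono) (auto simp: power2_eq_square power3_eq_cube)
  also have "\<dots> = 2 powr (2 * real d * L + slack d \<epsilon>)"
  proof -
    have "2 powr (3 * log 2 W) = W ^ 3"
      using W by (simp add: powr_powr[symmetric] mult.commute[of 3] flip: powr_numeral)
    moreover have "2 powr 12 = (4096::real)" by simp
    ultimately show ?thesis by (simp only: s powr_add) simp
  qed
  also have "\<dots> \<le> 2 powr real c"
    using label_size_bounds(1)[OF d \<epsilon>] by (intro powr_mono) (auto simp: c_def L_def)
  also have "\<dots> = 2 ^ c" by (simp add: powr_realpow)
  finally show ?thesis by (simp add: c_def)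
qed

section \<open>Asymptotics of the relative excess\<close>

lemma rel_excess_bound:
  assumes d: "d \<ge> 1" and \<epsilon>: "0 < \<epsilon>" "\<epsilon> < 1"
  shows "\<bar>rel_excess d \<epsilon>\<bar> \<le> (slack d \<epsilon> + 1) / (2 * real d * log 2 (1 / \<epsilon>))"
proof -
  have pos: "0 < 2 * real d * log 2 (1 / \<epsilon>)" using assms by simp
  have "log 2 (1 / \<epsilon>) \<noteq> 0" using pos by auto
  then have "rel_excess d \<epsilon> = (label_size d \<epsilon> - 2 * real d * log 2 (1 / \<epsilon>)) / (2 * real d * log 2 (1 / \<epsilon>))"
    using d by (simp add: rel_excess_def diff_divide_distrib)
  also have "\<bar>\<dots>\<bar> \<le> (slack d \<epsilon> + 1) / (2 * real d * log 2 (1 / \<epsilon>))"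
    unfolding abs_divide using label_size_bounds[OF assms] pos
    by (intro frac_le) auto
  finally show ?thesis .
qed

lemma slack_eq:
  assumes "0 < \<epsilon>" "\<epsilon> < 1"
  shows "slack d \<epsilon> = 3 * log 2 (real d + 1) + 3 * log 2 (log 2 (1 / \<epsilon>) + 1) + 12"
proof -
  have "0 < log 2 (1 / \<epsilon>)" using assms by simp
  then show ?thesis unfolding slack_def by (subst log_mult) auto
qed

text \<open>For fixed \<epsilon> the slack grows only logarithmically in \<open>d\<close>, against a
  linear main term.\<close>

lemma rel_excess_tendsto:
  assumes \<epsilon>: "0 < \<epsilon>" "\<epsilon> < 1"
  shows "(\<lambda>d. rel_excess d \<epsilon>) \<longlonglongrightarrow> 0"
proof (rule Lim_null_comparison)
  show "\<forall>\<^sub>F d in sequentially. norm (rel_excess d \<epsilon>) \<le> (slack d \<epsilon> + 1) / (2 * real d * log 2 (1 / \<epsilon>))"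
    using eventually_ge_at_top[of 1] by eventually_elim (use rel_excess_bound \<epsilon> in auto)
  define L K where "L = log 2 (1 / \<epsilon>)" and "K = 3 * log 2 (log 2 (1 / \<epsilon>) + 1) + 12"
  have "0 < L" using \<epsilon> by (simp add: L_def)
  then have "(\<lambda>d. (3 * log 2 (real d + 1) + K + 1) / (2 * real d * L)) \<longlonglongrightarrow> 0"
    by real_asymp
  then show "(\<lambda>d. (slack d \<epsilon> + 1) / (2 * real d * log 2 (1 / \<epsilon>))) \<longlonglongrightarrow> 0"
    using \<epsilon> by (simp add: slack_eq L_def K_def add.assoc)
qed

text \<open>Bounding \<open>log 2 (d + 1)\<close> by \<open>d\<close> lets \<open>d\<close> cancel.
  What remains depends on \<epsilon> alone and is of order \<open>log L / L\<close> with
  \<open>L = log 2 (1 / \<epsilon>)\<close> tending to infinity.\<close>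

lemma rel_excess_uniform_limit:
  "uniform_limit UNIV (\<lambda>\<epsilon> d. rel_excess d \<epsilon>) (\<lambda>_. 0) (at_right 0)"
proof -
  \<comment> \<open>The 16 collects 3 from \<open>3 * log 2 (d + 1) \<le> 3 * d\<close>, 12 from
    \<open>slack\<close> and 1 from rounding.\<close>
  let ?h = "\<lambda>\<epsilon>. (3 * log 2 (log 2 (1 / \<epsilon>) + 1) + 16) / (2 * log 2 (1 / \<epsilon>))"
  have bound: "\<bar>rel_excess d \<epsilon>\<bar> \<le> ?h \<epsilon>" if \<epsilon>: "0 < \<epsilon>" "\<epsilon> < 1" for d and \<epsilon> :: real
  proof -
    define L where "L = log 2 (1 / \<epsilon>)"
    have L: "0 < L" using \<epsilon> by (simp add: L_def)
    then have lL: "0 \<le> log 2 (L + 1)" by simp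
    show ?thesis
    proof (cases "d = 0")
      case True
      then show ?thesis using L lL by (simp add: rel_excess_def flip: L_def)
    next
      case False
      then have d: "1 \<le> d" by simp
      have "log 2 (real d + 1) \<le> real d"
      proof -
        have "real (Suc d) \<le> real (2 ^ d)"
          using Suc_leI[OF less_exp[of d]] by (simp only: of_nat_le_iff)
        then have "real d + 1 \<le> 2 ^ d" by simp
        then have "log 2 (real d + 1) \<le> log 2 (2 ^ d)" by (intro log_mono) auto
        then show ?thesis by simp
      qed
      moreover have "3 * log 2 (L + 1) + 13 \<le> real d * (3 * log 2 (L + 1) + 13)"
        using mult_right_mono[of 1 "real d" "3 * log 2 (L + 1) + 13"] d lL by simp
      ultimately have "slack d \<epsilon> + 1 \<le> real d * (3 * log 2 (L + 1) + 16)"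
        unfolding slack_eq[OF \<epsilon>] L_def[symmetric] by (simp add: algebra_simps)
      then have "(slack d \<epsilon> + 1) / (2 * real d * L) \<le> real d * (3 * log 2 (L + 1) + 16) / (2 * real d * L)"
        using L by (intro divide_right_mono) auto
      also have "\<dots> = ?h \<epsilon>" using d by (simp add: L_def)
      finally show ?thesis using rel_excess_bound[OF d \<epsilon>] by (simp add: L_def)
    qed
  qed
  have h: "(?h \<longlongrightarrow> 0) (at_right 0)" by real_asymp
  show ?thesis
  proof (rule uniform_limitI)
    fix e :: real assume e: "0 < e"
    have "\<forall>\<^sub>F \<epsilon> in at_right 0. ?h \<epsilon> < e" by (rule order_tendstoD(2)[OF h e])
    moreover have "\<forall>\<^sub>F \<epsilon>::real in at_right 0. 0 < \<epsilon> \<and> \<epsilon> < 1"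
      by (intro eventually_conj eventually_at_right_less) (auto simp: eventually_at_right_field intro!: exI[of _ 1])
    ultimately show "\<forall>\<^sub>F \<epsilon> in at_right 0. \<forall>d\<in>UNIV. dist (rel_excess d \<epsilon>) 0 < e"
    proof eventually_elim
      case (elim \<epsilon>)
      then show ?case using bound[of \<epsilon>] by (auto intro: le_less_trans)
    qed
  qed
qed

lemma label_size_eq:
  assumes "0 < \<epsilon>" "\<epsilon> < 1"
  shows "real (label_size d \<epsilon>) = 2 * real d * log 2 (1 / \<epsilon>) * (1 + rel_excess d \<epsilon>)"
proof (cases "d = 0")
  case False
  moreover have "0 < log 2 (1 / \<epsilon>)" using assms by simp
  ultimately show ?thesis by (simp add: rel_excess_def)
qed (simp add: label_size_def)

section \<open>Combination of scheme and asymptotics\<close>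

theorem theorem3p9:
  shows "\<exists>(c :: nat \<Rightarrow> real \<Rightarrow> nat) (g :: nat \<Rightarrow> real \<Rightarrow> real).
    (\<forall>d. \<forall>\<epsilon>\<in>{0<..<1}.
       (\<exists>E D. labeling_scheme (max_degree_graphs d) (c d \<epsilon>) E D \<and>
              (\<forall>n\<ge>2. forgery_prob (max_degree_graphs d) E D n \<le> \<epsilon>)) \<and>
       real (c d \<epsilon>) = 2 * real d * log 2 (1 / \<epsilon>) * (1 + g d \<epsilon>)) \<and>
    (\<forall>\<epsilon>\<in>{0<..<1}. (\<lambda>d. real (c d \<epsilon>)) \<in> O(\<lambda>d. real d)) \<and>
    (\<forall>\<epsilon>\<in>{0<..<1}. (\<lambda>d. g d \<epsilon>) \<longlonglongrightarrow> 0) \<and>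
    uniform_limit UNIV (\<lambda>\<epsilon> d. g d \<epsilon>) (\<lambda>_. 0) (at_right 0)"
proof (intro exI[of _ label_size] exI[of _ rel_excess] conjI ballI allI)
  fix d :: nat and \<epsilon> :: real assume "\<epsilon> \<in> {0<..<1}"
  then have \<epsilon>: "0 < \<epsilon>" "\<epsilon> < 1" by auto
  have "\<exists>R. forgery_resistant d \<epsilon> {xs :: label. length xs = label_size d \<epsilon>} R"
  proof (cases "d = 0")
    case True
    then show ?thesis using forgery_resistant_zero[of \<epsilon>] \<epsilon> by (auto simp: label_size_def)
  next
    case False
    then show ?thesis using \<epsilon> by (intro exists_forgery_resistant label_size_sufficient) auto
  qed
  then show "\<exists>E D. labeling_scheme (max_degree_graphs d) (label_size d \<epsilon>) E D \<and>
      (\<forall>n\<ge>2. forgery_prob (max_degree_graphs d) E D n \<le> \<epsilon>)"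
    using labeling_scheme_of_forgery_resistant \<epsilon> less_imp_le by blast
  show "real (label_size d \<epsilon>) = 2 * real d * log 2 (1 / \<epsilon>) * (1 + rel_excess d \<epsilon>)"
    by (rule label_size_eq[OF \<epsilon>])
next
  fix \<epsilon> :: real assume "\<epsilon> \<in> {0<..<1}"
  then have \<epsilon>: "0 < \<epsilon>" "\<epsilon> < 1" by auto
  show lim: "(\<lambda>d. rel_excess d \<epsilon>) \<longlonglongrightarrow> 0" by (rule rel_excess_tendsto[OF \<epsilon>])
  \<comment> \<open>A convergent factor is bounded, so the size is linear in \<open>d\<close> for
    fixed \<epsilon>.\<close>
  have "(\<lambda>d. 1 + rel_excess d \<epsilon>) \<in> O(\<lambda>_. 1)"
    using tendsto_add[OF tendsto_const lim, of 1] by (intro bigoI_tendsto[of _ _ 1]) auto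
  then have "(\<lambda>d. real d * (1 + rel_excess d \<epsilon>)) \<in> O(\<lambda>d. real d * 1)"
    by (rule landau_o.big.mult[OF landau_o.big_refl])
  moreover have "2 * log 2 (1 / \<epsilon>) \<noteq> 0"
  proof -
    have "0 < log 2 (1 / \<epsilon>)" using \<epsilon> by simp
    then show ?thesis by linarith
  qed
  ultimately have "(\<lambda>d. 2 * log 2 (1 / \<epsilon>) * (real d * (1 + rel_excess d \<epsilon>))) \<in> O(\<lambda>d. real d)"
    by (subst landau_o.big.cmult_in_iff) simp_all
  then show "(\<lambda>d. real (label_size d \<epsilon>)) \<in> O(\<lambda>d. real d)"
    by (simp add: label_size_eq[OF \<epsilon>] mult_ac)
qed (rule rel_excess_uniform_limit)

end
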